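(* Let $A_{ij}$, $1\le i\le k$, $1\le j\le n$, be positive semidefinite Hermitian matrices, all of the same order, such that for each $i$, $A_{i1}\preceq_L A_{i2}\preceq_L\cdots\preceq_L A_{in}$. Then for all permutations $\sigma_1,\dots,\sigma_k\in S_n$, $$\sum_{i=1}^n\bigodot_{j=1}^k A_{j\sigma_j(i)}\preceq_L\sum_{i=1}^n\bigodot_{j=1}^k A_{ji}$$ and $$\bigodot_{i=1}^n\sum_{j=1}^k A_{j\sigma_j(i)}\succeq_L\bigodot_{i=1}^n\sum_{j=1}^k A_{ji}.$$
   Context: $\preceq_L$ is the Loewner partial order on Hermitian matrices: $A\succeq_L B$ if and only if $A-B$ is positive semidefinite. $\odot$ is the Hadamard (entrywise) product of matrices and $\bigodot$ the corresponding iterated product. $S_n$ is the symmetric group on $\{1,\dots,n\}$. *)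

theory Defs
  imports "HOL-Analysis.Analysis" "HOL-Combinatorics.Permutations"
begin

definition hermitian_matrix :: "complex ^ 'm ^ 'm \<Rightarrow> bool" where
  "hermitian_matrix A \<longleftrightarrow> (\<forall>r c. A $ c $ r = cnj (A $ r $ c))"

(* The quadratic form of a Hermitian matrix takes only real values, so the real part loses nothing. *)
definition pos_semidef :: "complex ^ 'm ^ 'm \<Rightarrow> bool" where
  "pos_semidef A \<longleftrightarrow>
     hermitian_matrix A \<and> (\<forall>x. 0 \<le> Re (\<Sum>r\<in>UNIV. cnj (x $ r) * (A *v x) $ r))"

definition loewner_le :: "complex ^ 'm ^ 'm \<Rightarrow> complex ^ 'm ^ 'm \<Rightarrow> bool"
    (infix "\<preceq>\<^sub>L" 50) where
  "A \<preceq>\<^sub>L B \<longleftrightarrow> pos_semidef (B - A)"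

abbreviation loewner_ge :: "complex ^ 'm ^ 'm \<Rightarrow> complex ^ 'm ^ 'm \<Rightarrow> bool"
    (infix "\<succeq>\<^sub>L" 50) where
  "A \<succeq>\<^sub>L B \<equiv> B \<preceq>\<^sub>L A"

(* The library's multiplication of the type of matrices is entrywise (matrix_matrix_mult is
   the usual product), so it is the Hadamard product and \<Prod> is the iterated Hadamard
   product; the empty product is the all-ones matrix. *)
lemma hadamard_entry: "(A * B) $ r $ c = A $ r $ c * B $ r $ c"
  for A B :: "complex ^ 'n ^ 'm"
  by simp

lemma hadamard_prod_entry: "(\<Prod>i\<in>I. A i) $ r $ c = (\<Prod>i\<in>I. A i $ r $ c)"
  for A :: "'i \<Rightarrow> complex ^ 'n ^ 'm"
  by (induction I rule: infinite_finite_induct) simp_all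

end

theory Submission
  imports Defs
begin

text \<open>
  Under the entrywise product the matrices form a commutative ring in which, by Schur's product
  theorem, the positive semidefinite matrices are closed under sums and products. In any such ring
  the rearrangement inequalities follow by sorting two rows at a time: if \<open>X \<le> X'\<close> and
  \<open>Y' \<le> Y\<close>, both claims reduce to \<open>0 \<le> (X' - X) * (Y - Y')\<close>. Repeatedly sorting pairs of rows ends
  with all permutations being the identity.
\<close>

subsection \<open>Sorting rows pairwise\<close>

text \<open>All rows inverted at positions \<open>a\<close>, \<open>b\<close> are exchanged at once.
  Exchanging in one row alone need not move the sums in the right direction.\<close>

definition sort_pair :: "nat \<Rightarrow> nat \<Rightarrow> ('i \<Rightarrow> nat \<Rightarrow> nat) \<Rightarrow> 'i \<Rightarrow> nat \<Rightarrow> nat" where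
  "sort_pair a b \<sigma> j = (if \<sigma> j b < \<sigma> j a then \<sigma> j \<circ> Transposition.transpose a b else \<sigma> j)"

lemma sort_pair_apply_other: "l \<noteq> a \<Longrightarrow> l \<noteq> b \<Longrightarrow> sort_pair a b \<sigma> j l = \<sigma> j l"
  by (simp add: sort_pair_def transpose_apply_other)

lemma permutes_sort_pair:
  assumes "\<sigma> j permutes S" "a \<in> S" "b \<in> S"
  shows "sort_pair a b \<sigma> j permutes S"
  using assms by (auto simp: sort_pair_def intro: permutes_compose permutes_swap_id)

text \<open>Injectivity makes \<open>p\<close> strictly increasing, so \<open>i \<le> p i\<close> by
  induction, and a permutation that lowers no point is the identity.\<close>

lemma permutes_mono_eq_id:
  fixes p :: "nat \<Rightarrow> nat"
  assumes p: "p permutes {1..n}"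
    and mono: "\<And>a b. a \<in> {1..n} \<Longrightarrow> b \<in> {1..n} \<Longrightarrow> a < b \<Longrightarrow> p a \<le> p b"
  shows "p = id"
proof -
  have "i \<le> p i" if "i \<in> {1..n}" for i
    using that
  proof (induction i)
    case (Suc i)
    show ?case
    proof (cases "i = 0")
      case True
      have "p (Suc i) \<in> {1..n}"
        using permutes_in_image[OF p] Suc.prems by blast
      then show ?thesis using True by simp
    next
      case False
      then have i: "i \<in> {1..n}" using Suc.prems by auto
      have "p i \<noteq> p (Suc i)"
        using permutes_inj[OF p] by (metis injD n_not_Suc_n)
      then show ?thesis
        using Suc.IH[OF i] mono[OF i Suc.prems] by simp
    qed
  qed simp
  then show ?thesis
    using permutes_natset_ge[OF p] by blast
qed

lemma sum_split_pair:
  assumes "finite S" "a \<in> S" "b \<in> S" "a \<noteq> b"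
  shows "sum f S = f a + f b + sum f (S - {a, b})"
  using sum.subset_diff[of "{a, b}" S f] assms by (simp add: add.commute)

lemma prod_split_pair:
  assumes "finite S" "a \<in> S" "b \<in> S" "a \<noteq> b"
  shows "prod f S = f a * f b * prod f (S - {a, b})"
  using prod.subset_diff[of "{a, b}" S f] assms by (simp add: mult.commute)

text \<open>The termination measure for sorting: the weights \<open>n - i\<close> decrease with the
  position, so moving the larger value to the later position lowers the sum. Rows without an
  inversion stay as they are.\<close>

lemma weighted_sum_sort_pair:
  fixes \<sigma> :: "'i \<Rightarrow> nat \<Rightarrow> nat"
  assumes ab: "a \<in> {1..n}" "b \<in> {1..n}" "a < b"
  shows "(\<Sum>i = 1..n. (n - i) * sort_pair a b \<sigma> j i) \<le> (\<Sum>i = 1..n. (n - i) * \<sigma> j i)"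
    and "\<sigma> j b < \<sigma> j a \<Longrightarrow>
      (\<Sum>i = 1..n. (n - i) * sort_pair a b \<sigma> j i) < (\<Sum>i = 1..n. (n - i) * \<sigma> j i)"
proof -
  show less: "(\<Sum>i = 1..n. (n - i) * sort_pair a b \<sigma> j i) < (\<Sum>i = 1..n. (n - i) * \<sigma> j i)"
    if lt: "\<sigma> j b < \<sigma> j a"
  proof -
    have split: "(\<Sum>i = 1..n. f i) = f a + f b + sum f ({1..n} - {a, b})" for f :: "nat \<Rightarrow> nat"
      using ab by (intro sum_split_pair) auto
    obtain d where d: "\<sigma> j a = \<sigma> j b + d" "d > 0"
      using less_imp_add_positive[OF lt] by metis
    obtain e where e: "n - a = (n - b) + e" "e > 0"
    proof
      show "n - a = (n - b) + (b - a)" "b - a > 0" using ab by auto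
    qed
    \<comment> \<open>The two sides differ by \<open>e * d\<close>, the gap of the weights times the
      gap of the values.\<close>
    have "(n - a) * \<sigma> j b + (n - b) * \<sigma> j a < (n - a) * \<sigma> j a + (n - b) * \<sigma> j b"
      unfolding d e using \<open>d > 0\<close> \<open>e > 0\<close> by (simp add: algebra_simps)
    moreover have "sum (\<lambda>i. (n - i) * sort_pair a b \<sigma> j i) ({1..n} - {a, b})
        = sum (\<lambda>i. (n - i) * \<sigma> j i) ({1..n} - {a, b})"
      by (intro sum.cong) (auto simp: sort_pair_apply_other)
    ultimately show ?thesis
      unfolding split[of "\<lambda>i. (n - i) * sort_pair a b \<sigma> j i"] split[of "\<lambda>i. (n - i) * \<sigma> j i"]
      using lt by (simp add: sort_pair_def)
  qed
  show "(\<Sum>i = 1..n. (n - i) * sort_pair a b \<sigma> j i) \<le> (\<Sum>i = 1..n. (n - i) * \<sigma> j i)"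
    using less by (cases "\<sigma> j b < \<sigma> j a") (auto simp: sort_pair_def)
qed

text \<open>Induction on the weighted sum over all rows in \<open>K\<close>. An inversion in some
  row allows a sorting step that lowers it; with no inversion left, every row is the identity. The
  induction step therefore passes from the sorted family back to the unsorted one.\<close>

lemma sort_rows_induct:
  fixes \<sigma> :: "'i \<Rightarrow> nat \<Rightarrow> nat"
  assumes "finite K"
    and "\<And>j. j \<in> K \<Longrightarrow> \<sigma> j permutes {1..n}"
    and base: "\<And>\<sigma>. (\<And>j. j \<in> K \<Longrightarrow> \<sigma> j = id) \<Longrightarrow> Q \<sigma>"
    and step: "\<And>\<sigma> a b. (\<And>j. j \<in> K \<Longrightarrow> \<sigma> j permutes {1..n}) \<Longrightarrow> a \<in> {1..n} \<Longrightarrow> b \<in> {1..n} \<Longrightarrow>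
      a < b \<Longrightarrow> Q (sort_pair a b \<sigma>) \<Longrightarrow> Q \<sigma>"
  shows "Q \<sigma>"
  using assms(2)
proof (induction "\<Sum>j\<in>K. \<Sum>i = 1..n. (n - i) * \<sigma> j i" arbitrary: \<sigma> rule: less_induct)
  case less
  show ?case
  proof (cases "\<exists>j\<in>K. \<exists>a\<in>{1..n}. \<exists>b\<in>{1..n}. a < b \<and> \<sigma> j b < \<sigma> j a")
    case True
    then obtain j a b where j: "j \<in> K" "\<sigma> j b < \<sigma> j a"
      and ab: "a \<in> {1..n}" "b \<in> {1..n}" "a < b"
      by blast
    have "(\<Sum>j\<in>K. \<Sum>i = 1..n. (n - i) * sort_pair a b \<sigma> j i) < (\<Sum>j\<in>K. \<Sum>i = 1..n. (n - i) * \<sigma> j i)"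
      using \<open>finite K\<close> j weighted_sum_sort_pair[OF ab, of \<sigma>]
      by (intro sum_strict_mono_ex1) auto
    then have "Q (sort_pair a b \<sigma>)"
      by (rule less.hyps) (intro permutes_sort_pair less.prems ab)
    then show ?thesis
      using step[of \<sigma> a b] less.prems ab by blast
  next
    case False
    then have "\<sigma> j = id" if "j \<in> K" for j
      using permutes_mono_eq_id[OF less.prems[OF that]] that by (meson not_less)
    then show ?thesis by (rule base)
  qed
qed

subsection \<open>Rearrangement in a commutative ring with a positive cone\<close>

locale positive_cone =
  fixes P :: "'a::comm_ring_1 set"
  assumes zero_mem: "0 \<in> P"
    and one_mem: "1 \<in> P"
    and add_mem: "x \<in> P \<Longrightarrow> y \<in> P \<Longrightarrow> x + y \<in> P"
    and mult_mem: "x \<in> P \<Longrightarrow> y \<in> P \<Longrightarrow> x * y \<in> P"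
begin

lemma sum_mem: "(\<And>i. i \<in> I \<Longrightarrow> f i \<in> P) \<Longrightarrow> sum f I \<in> P"
  by (induction I rule: infinite_finite_induct) (auto simp: zero_mem add_mem)

lemma prod_mem: "(\<And>i. i \<in> I \<Longrightarrow> f i \<in> P) \<Longrightarrow> prod f I \<in> P"
  by (induction I rule: infinite_finite_induct) (auto simp: one_mem mult_mem)

lemma sum_diff_mem: "(\<And>i. i \<in> I \<Longrightarrow> g i - f i \<in> P) \<Longrightarrow> sum g I - sum f I \<in> P"
  by (simp add: sum_mem flip: sum_subtractf)

text \<open>Telescoping: \<open>g x * G - f x * F\<close> equals
  \<open>(g x - f x) * G + f x * (G - F)\<close>, where \<open>G\<close> and \<open>F\<close> are
  the remaining products and \<open>G\<close> lies in \<open>P\<close> because each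
  \<open>g i\<close> is \<open>f i\<close> plus an element of \<open>P\<close>.\<close>

lemma prod_diff_mem:
  assumes "\<And>i. i \<in> I \<Longrightarrow> f i \<in> P" "\<And>i. i \<in> I \<Longrightarrow> g i - f i \<in> P"
  shows "prod g I - prod f I \<in> P"
  using assms
proof (induction I rule: infinite_finite_induct)
  case (insert x F)
  have "g i \<in> P" if "i \<in> F" for i
    using add_mem[of "f i" "g i - f i"] insert.prems that by simp
  then have "(g x - f x) * prod g F + f x * (prod g F - prod f F) \<in> P"
    using insert by (intro add_mem mult_mem prod_mem) auto
  then show ?case
    using insert.hyps by (simp add: algebra_simps)
qed (simp_all add: zero_mem)

lemma chain_diff_mem:
  fixes A :: "nat \<Rightarrow> 'a"
  assumes "\<And>j. j \<in> {1..<n} \<Longrightarrow> A (Suc j) - A j \<in> P" "a \<in> {1..n}" "b \<in> {1..n}" "a \<le> b"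
  shows "A b - A a \<in> P"
  using \<open>a \<le> b\<close> \<open>b \<in> {1..n}\<close>
proof (induction b rule: dec_induct)
  case base
  then show ?case by (simp add: zero_mem)
next
  case (step b)
  then have "(A (Suc b) - A b) + (A b - A a) \<in> P"
    using assms(1)[of b] \<open>a \<in> {1..n}\<close> by (intro add_mem) auto
  then show ?case by simp
qed

section \<open>Effect of one sorting step, and the resulting rearrangement inequalities\<close>

context
  fixes A :: "'i \<Rightarrow> nat \<Rightarrow> 'a" and K :: "'i set" and n :: nat
  assumes finite_K: "finite K"
    and A_mem: "\<And>j i. j \<in> K \<Longrightarrow> i \<in> {1..n} \<Longrightarrow> A j i \<in> P"
    and A_chain: "\<And>j i. j \<in> K \<Longrightarrow> i \<in> {1..<n} \<Longrightarrow> A j (Suc i) - A j i \<in> P"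
begin

lemma A_mono: "j \<in> K \<Longrightarrow> a \<in> {1..n} \<Longrightarrow> b \<in> {1..n} \<Longrightarrow> a \<le> b \<Longrightarrow> A j b - A j a \<in> P"
  using chain_diff_mem[of n "A j"] A_chain by blast

context
  fixes \<sigma> :: "'i \<Rightarrow> nat \<Rightarrow> nat" and a b :: nat
  assumes perm: "\<And>j. j \<in> K \<Longrightarrow> \<sigma> j permutes {1..n}"
    and ab: "a \<in> {1..n}" "b \<in> {1..n}" "a < b"
begin

lemma perm_mem: "j \<in> K \<Longrightarrow> i \<in> {1..n} \<Longrightarrow> \<sigma> j i \<in> {1..n}"
  using permutes_in_image[OF perm] by blast

text \<open>The rows that the sorting step changes. From \<open>a\<close> to \<open>b\<close> the
  entries go down on \<open>J\<close> and up on \<open>K - J\<close>, which is the source of the two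
  opposite differences below.\<close>

abbreviation "J \<equiv> {j \<in> K. \<sigma> j b < \<sigma> j a}"

text \<open>Only the terms at \<open>a\<close> and \<open>b\<close> change. With \<open>X\<close>
  and \<open>Y\<close> the partial products over \<open>K - J\<close> and \<open>J\<close>, sorting
  exchanges \<open>Y a\<close> and \<open>Y b\<close>, and the gain
  \<open>X a * Y b + X b * Y a - X a * Y a - X b * Y b\<close> factors as
  \<open>(X b - X a) * (Y a - Y b)\<close>.\<close>

lemma sum_of_prods_sort_pair:
  "(\<Sum>i = 1..n. \<Prod>j\<in>K. A j (sort_pair a b \<sigma> j i)) - (\<Sum>i = 1..n. \<Prod>j\<in>K. A j (\<sigma> j i)) \<in> P"
proof -
  define X where "X i = (\<Prod>j\<in>K - J. A j (\<sigma> j i))" for i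
  define Y where "Y i = (\<Prod>j\<in>J. A j (\<sigma> j i))" for i
  have row: "(\<Prod>j\<in>K. f j) = (\<Prod>j\<in>K - J. f j) * (\<Prod>j\<in>J. f j)" for f :: "'i \<Rightarrow> 'a"
    using finite_K by (intro prod.subset_diff) auto
  have rows: "(\<Sum>i = 1..n. f i) = f a + f b + sum f ({1..n} - {a, b})" for f :: "nat \<Rightarrow> 'a"
      using ab by (intro sum_split_pair) auto
  have "X b - X a \<in> P"
    unfolding X_def using A_mem A_mono perm_mem ab by (intro prod_diff_mem) auto
  moreover have "Y a - Y b \<in> P"
    unfolding Y_def using A_mem A_mono perm_mem ab by (intro prod_diff_mem) auto
  ultimately have "(X b - X a) * (Y a - Y b) \<in> P"
    by (rule mult_mem)
  moreover have "(\<Prod>j\<in>K. A j (\<sigma> j i)) = X i * Y i" for i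
    by (simp add: row X_def Y_def)
  moreover have "(\<Prod>j\<in>K. A j (sort_pair a b \<sigma> j a)) = X a * Y b"
    "(\<Prod>j\<in>K. A j (sort_pair a b \<sigma> j b)) = X b * Y a"
    unfolding row X_def Y_def
    by (intro arg_cong2[of _ _ _ _ "(*)"] prod.cong; auto simp: sort_pair_def)+
  moreover have "(\<Sum>i\<in>{1..n} - {a, b}. \<Prod>j\<in>K. A j (sort_pair a b \<sigma> j i))
      = (\<Sum>i\<in>{1..n} - {a, b}. \<Prod>j\<in>K. A j (\<sigma> j i))"
    by (intro sum.cong prod.cong) (auto simp: sort_pair_apply_other)
  ultimately show ?thesis
    unfolding rows by (simp add: algebra_simps)
qed

text \<open>With partial sums instead,
  \<open>(X a + Y a) * (X b + Y b) - (X a + Y b) * (X b + Y a)\<close> is again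
  \<open>(X b - X a) * (Y a - Y b)\<close>, but now as a loss under sorting. The factors at the
  other positions contribute the common multiple \<open>R\<close>.\<close>

lemma prod_of_sums_sort_pair:
  "(\<Prod>i = 1..n. \<Sum>j\<in>K. A j (\<sigma> j i)) - (\<Prod>i = 1..n. \<Sum>j\<in>K. A j (sort_pair a b \<sigma> j i)) \<in> P"
proof -
  define X where "X i = (\<Sum>j\<in>K - J. A j (\<sigma> j i))" for i
  define Y where "Y i = (\<Sum>j\<in>J. A j (\<sigma> j i))" for i
  define R where "R = (\<Prod>i\<in>{1..n} - {a, b}. \<Sum>j\<in>K. A j (\<sigma> j i))"
  have row: "(\<Sum>j\<in>K. f j) = (\<Sum>j\<in>K - J. f j) + (\<Sum>j\<in>J. f j)" for f :: "'i \<Rightarrow> 'a"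
    using finite_K by (intro sum.subset_diff) auto
  have rows: "(\<Prod>i = 1..n. f i) = f a * f b * prod f ({1..n} - {a, b})" for f :: "nat \<Rightarrow> 'a"
      using ab by (intro prod_split_pair) auto
  have "X b - X a \<in> P"
    unfolding X_def using A_mono perm_mem ab by (intro sum_diff_mem) auto
  moreover have "Y a - Y b \<in> P"
    unfolding Y_def using A_mono perm_mem ab by (intro sum_diff_mem) auto
  moreover have "R \<in> P"
    unfolding R_def using A_mem perm_mem by (intro prod_mem sum_mem) auto
  ultimately have "(X b - X a) * (Y a - Y b) * R \<in> P"
    by (intro mult_mem)
  moreover have "(\<Sum>j\<in>K. A j (\<sigma> j i)) = X i + Y i" for i
    by (simp add: row X_def Y_def)
  moreover have "(\<Sum>j\<in>K. A j (sort_pair a b \<sigma> j a)) = X a + Y b"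
    "(\<Sum>j\<in>K. A j (sort_pair a b \<sigma> j b)) = X b + Y a"
    unfolding row X_def Y_def
    by (intro arg_cong2[of _ _ _ _ "(+)"] sum.cong; auto simp: sort_pair_def)+
  moreover have "(\<Prod>i\<in>{1..n} - {a, b}. \<Sum>j\<in>K. A j (sort_pair a b \<sigma> j i)) = R"
    unfolding R_def by (intro sum.cong prod.cong) (auto simp: sort_pair_apply_other)
  ultimately show ?thesis
    unfolding rows R_def[symmetric] by (simp add: algebra_simps)
qed

end

lemma sum_of_prods_rearrangement:
  assumes "\<And>j. j \<in> K \<Longrightarrow> \<sigma> j permutes {1..n}"
  shows "(\<Sum>i = 1..n. \<Prod>j\<in>K. A j i) - (\<Sum>i = 1..n. \<Prod>j\<in>K. A j (\<sigma> j i)) \<in> P" (is "?Q \<sigma>")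
proof (rule sort_rows_induct[where Q = ?Q, OF finite_K assms])
  fix \<sigma> a b
  assume "\<And>j. j \<in> K \<Longrightarrow> \<sigma> j permutes {1..n}" "a \<in> {1..n}" "b \<in> {1..n}" "a < b"
  note diff = sum_of_prods_sort_pair[of \<sigma>, OF this]
  assume "?Q (sort_pair a b \<sigma>)"
  \<comment> \<open>The difference from \<sigma> to the identity telescopes through the sorted
    family.\<close>
  from add_mem[OF this diff] show "?Q \<sigma>"
    by simp
qed (simp_all add: zero_mem)

lemma prod_of_sums_rearrangement:
  assumes "\<And>j. j \<in> K \<Longrightarrow> \<sigma> j permutes {1..n}"
  shows "(\<Prod>i = 1..n. \<Sum>j\<in>K. A j (\<sigma> j i)) - (\<Prod>i = 1..n. \<Sum>j\<in>K. A j i) \<in> P" (is "?Q \<sigma>")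
proof (rule sort_rows_induct[where Q = ?Q, OF finite_K assms])
  fix \<sigma> a b
  assume "\<And>j. j \<in> K \<Longrightarrow> \<sigma> j permutes {1..n}" "a \<in> {1..n}" "b \<in> {1..n}" "a < b"
  note diff = prod_of_sums_sort_pair[of \<sigma>, OF this]
  assume "?Q (sort_pair a b \<sigma>)"
  from add_mem[OF this diff] show "?Q \<sigma>"
    by simp
qed (simp_all add: zero_mem)

end

end

subsection \<open>The Schur product theorem\<close>

definition quad_form :: "complex ^ 'm ^ 'm \<Rightarrow> complex ^ 'm \<Rightarrow> complex" where
  "quad_form A x = (\<Sum>r\<in>UNIV. \<Sum>c\<in>UNIV. cnj (x $ r) * A $ r $ c * x $ c)"

text \<open>Oriented so that rewriting removes conjugates; the defining equation would apply again
  to its own right-hand side.\<close>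

lemma hermitian_matrix_iff_cnj: "hermitian_matrix A \<longleftrightarrow> (\<forall>r c. cnj (A $ r $ c) = A $ c $ r)"
  unfolding hermitian_matrix_def by metis

lemma pos_semidef_iff_quad_form:
  "pos_semidef A \<longleftrightarrow> hermitian_matrix A \<and> (\<forall>x. 0 \<le> Re (quad_form A x))"
  by (simp add: pos_semidef_def quad_form_def matrix_vector_mult_def sum_distrib_left mult.assoc)

lemma quad_form_add: "quad_form (A + B) x = quad_form A x + quad_form B x"
  by (simp add: quad_form_def algebra_simps sum.distrib)

lemma pos_semidef_add: "pos_semidef A \<Longrightarrow> pos_semidef B \<Longrightarrow> pos_semidef (A + B)"
  by (simp add: pos_semidef_iff_quad_form quad_form_add hermitian_matrix_iff_cnj)

lemma pos_semidef_zero: "pos_semidef 0"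
  by (simp add: pos_semidef_iff_quad_form quad_form_def hermitian_matrix_iff_cnj)

text \<open>The matrix \<open>v v^*\<close>, of rank at most one.\<close>

definition outer :: "complex ^ 'm \<Rightarrow> complex ^ 'm ^ 'm" where
  "outer v = (\<chi> r c. v $ r * cnj (v $ c))"

text \<open>Entrywise multiplication by \<open>outer v\<close> is the congruence
  \<open>D B D^*\<close> with \<open>D\<close> the diagonal matrix of \<open>v\<close>, so the form
  of the product is the form of \<open>B\<close> at a rescaled vector.\<close>

lemma pos_semidef_outer_mult:
  assumes "pos_semidef B"
  shows "pos_semidef (outer v * B)"
proof -
  have "quad_form (outer v * B) x = quad_form B (\<chi> r. cnj (v $ r) * x $ r)" for x
    by (simp add: quad_form_def outer_def algebra_simps)
  then show ?thesis
    using assms by (auto simp: pos_semidef_iff_quad_form hermitian_matrix_iff_cnj outer_def)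
qed

text \<open>Here \<open>1\<close> is the all-ones matrix, whose form is the squared modulus of the
  coordinate sum.\<close>

lemma pos_semidef_one: "pos_semidef (1 :: complex ^ 'm ^ 'm)"
proof -
  have "0 \<le> Re (quad_form 1 x)" for x :: "complex ^ 'm"
  proof -
    define s where "s = (\<Sum>r\<in>UNIV. x $ r)"
    have "quad_form 1 x = cnj s * s"
      by (simp add: quad_form_def s_def sum_product)
    then show ?thesis by simp
  qed
  then show ?thesis
    by (simp add: pos_semidef_iff_quad_form hermitian_matrix_iff_cnj)
qed

section \<open>The quadratic form when a single coordinate varies\<close>

lemma sum_mult_axis: "(\<Sum>c\<in>UNIV. f c * axis p z $ c) = f p * (z :: complex)"
proof -
  have "(\<Sum>c\<in>UNIV. f c * axis p z $ c) = (\<Sum>c\<in>UNIV. if c = p then f p * z else 0)"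
    by (intro sum.cong) (auto simp: axis_def)
  then show ?thesis by simp
qed

lemma sum_cnj_axis_mult: "(\<Sum>r\<in>UNIV. cnj (axis p z $ r) * f r) = cnj z * f p"
proof -
  have "(\<Sum>r\<in>UNIV. cnj (axis p z $ r) * f r) = (\<Sum>r\<in>UNIV. if r = p then cnj z * f p else 0)"
    by (intro sum.cong) (auto simp: axis_def)
  then show ?thesis by simp
qed

text \<open>The two cross terms are conjugate because \<open>A\<close> is Hermitian, hence the
  factor 2. Suitable choices of \<open>z\<close> give both the vanishing of rows with zero diagonal
  entry and the Schur complement.\<close>

lemma quad_form_add_axis:
  assumes "hermitian_matrix A"
  shows "Re (quad_form A (x + axis p z))
    = Re (quad_form A x) + 2 * Re (cnj z * (\<Sum>c\<in>UNIV. A $ p $ c * x $ c))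
      + (cmod z)\<^sup>2 * Re (A $ p $ p)"
proof -
  define w where "w = (\<Sum>c\<in>UNIV. A $ p $ c * x $ c)"
  have col: "(\<Sum>r\<in>UNIV. cnj (x $ r) * A $ r $ p) = cnj w"
  proof -
    have "cnj (A $ p $ r) = A $ r $ p" for r
      using assms by (simp add: hermitian_matrix_iff_cnj)
    then show ?thesis
      by (simp add: w_def mult.commute)
  qed
  have "quad_form A (x + axis p z)
      = quad_form A x + (\<Sum>r\<in>UNIV. cnj (axis p z $ r) * (\<Sum>c\<in>UNIV. A $ r $ c * x $ c))
        + (\<Sum>r\<in>UNIV. \<Sum>c\<in>UNIV. (cnj (x $ r) * A $ r $ c) * axis p z $ c)
        + (\<Sum>r\<in>UNIV. cnj (axis p z $ r) * (\<Sum>c\<in>UNIV. A $ r $ c * axis p z $ c))"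
    by (simp add: quad_form_def sum_distrib_left sum.distrib algebra_simps)
  also have "\<dots> = quad_form A x + cnj z * w + cnj w * z + cnj z * (A $ p $ p * z)"
    by (simp add: sum_mult_axis sum_cnj_axis_mult col flip: w_def sum_distrib_right)
  finally have "Re (quad_form A (x + axis p z))
      = Re (quad_form A x) + Re (cnj z * w) + Re (cnj w * z) + Re (cnj z * (A $ p $ p * z))"
    by simp
  moreover have "Re (cnj z * (A $ p $ p * z)) = (cmod z)\<^sup>2 * Re (A $ p $ p)"
    unfolding cmod_power2 by (simp add: power2_eq_square algebra_simps)
  ultimately show ?thesis
    unfolding w_def[symmetric] by simp
qed

lemma quad_form_axis:
  assumes "hermitian_matrix A"
  shows "Re (quad_form A (axis p 1)) = Re (A $ p $ p)"
  using quad_form_add_axis[OF assms, of 0 p 1] by (simp add: quad_form_def)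

lemma pos_semidef_diag:
  assumes "pos_semidef A"
  shows "A $ p $ p = of_real (Re (A $ p $ p))" "0 \<le> Re (A $ p $ p)"
proof -
  have "A $ p $ p = cnj (A $ p $ p)"
    using assms unfolding pos_semidef_def hermitian_matrix_def by blast
  then show "A $ p $ p = of_real (Re (A $ p $ p))"
    by (simp add: complex_eq_iff)
  show "0 \<le> Re (A $ p $ p)"
    using assms quad_form_axis[of A p] unfolding pos_semidef_iff_quad_form by metis
qed

text \<open>Without the diagonal term the form is affine along axis \<open>p\<close>, so a nonzero
  \<open>A $ p $ r\<close> would let it become negative.\<close>

lemma pos_semidef_zero_diag:
  assumes "pos_semidef A" "A $ p $ p = 0"
  shows "A $ p $ r = 0"
proof (rule ccontr)
  assume nz: "A $ p $ r \<noteq> 0"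
  define w where "w = A $ p $ r"
  \<comment> \<open>Chosen so that \<open>2 * t * (cmod w)\<^sup>2\<close> exceeds the diagonal
    entry at \<open>r\<close> by 1 and the form takes the value -1.\<close>
  define t where "t = (Re (A $ r $ r) + 1) / (2 * (cmod w)\<^sup>2)"
  have herm: "hermitian_matrix A"
    using assms by (simp add: pos_semidef_def)
  have "0 \<le> Re (quad_form A (axis r 1 + axis p (- of_real t * w)))"
    using assms unfolding pos_semidef_iff_quad_form by blast
  also have "\<dots> = Re (A $ r $ r) - 2 * t * (cmod w)\<^sup>2"
    unfolding quad_form_add_axis[OF herm] quad_form_axis[OF herm] sum_mult_axis cmod_power2
    by (simp add: assms w_def power2_eq_square algebra_simps)
  also have "\<dots> = -1"
    using nz by (simp add: t_def w_def field_simps)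
  finally show False by simp
qed

text \<open>One step of the Cholesky decomposition: \<open>A - outer v\<close> is the Schur complement of the
  diagonal entry \<open>p\<close>.\<close>

lemma pos_semidef_eliminate:
  fixes A :: "complex ^ 'm ^ 'm"
  assumes "pos_semidef A"
  obtains v where "pos_semidef (A - outer v)" "\<And>c. (A - outer v) $ p $ c = 0"
    "\<And>r. A $ r $ p = 0 \<Longrightarrow> v $ r = 0"
proof -
  define a where "a = Re (A $ p $ p)"
  have a: "A $ p $ p = of_real a" "0 \<le> a"
    using pos_semidef_diag[OF assms] by (auto simp: a_def)
  have herm: "hermitian_matrix A"
    using assms by (simp add: pos_semidef_def)
  then have cnj_A: "cnj (A $ r $ c) = A $ c $ r" for r c
    by (simp add: hermitian_matrix_iff_cnj)
  show thesis
  proof (cases "a = 0")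
    case True
    \<comment> \<open>A zero pivot means that row \<open>p\<close> already vanishes, so nothing has
      to be subtracted.\<close>
    have "A - outer 0 = A"
      by (simp add: outer_def vec_eq_iff)
    with True show ?thesis
      using that[of 0] assms a pos_semidef_zero_diag[OF assms, of p] by simp
  next
    case False
    then have "a > 0" using a by simp
    \<comment> \<open>Column \<open>p\<close> divided by the root of the pivot, so that
      \<open>outer v\<close> agrees with \<open>A\<close> in row \<open>p\<close>.\<close>
    define v where "v = (\<chi> r. A $ r $ p / of_real (sqrt a))"
    have outer_v: "outer v $ r $ c = A $ r $ p * A $ p $ c / of_real a" for r c
      using \<open>a > 0\<close> by (simp add: outer_def v_def cnj_A flip: of_real_mult)
    have "0 \<le> Re (quad_form (A - outer v) x)" for x
    proof -
      define w where "w = (\<Sum>c\<in>UNIV. A $ p $ c * x $ c)"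
      have "quad_form (outer v) x = (\<Sum>r\<in>UNIV. \<Sum>c\<in>UNIV. cnj (A $ p $ r * x $ r) * (A $ p $ c * x $ c)) / of_real a"
        by (simp add: quad_form_def outer_v cnj_A sum_divide_distrib mult_ac)
      also have "\<dots> = cnj w * w / of_real a"
        by (simp add: w_def sum_product)
      finally have "Re (quad_form (outer v) x) = (cmod w)\<^sup>2 / a"
        unfolding cmod_power2 by (simp add: power2_eq_square)
      \<comment> \<open>Completing the square: this shift minimises the form of \<open>A\<close>
        over the changes of coordinate \<open>p\<close>, and the minimum is the form of
        \<open>A - outer v\<close> at \<open>x\<close>.\<close>
      moreover have "Re (quad_form A (x + axis p (- w / of_real a)))
          = Re (quad_form A x) - (cmod w)\<^sup>2 / a"
      proof -
        have "Re (cnj (- w / of_real a) * w) = - (cmod w)\<^sup>2 / a"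
          unfolding cmod_power2 by (simp add: power2_eq_square diff_divide_distrib add_divide_distrib)
        moreover have "(cmod (- w / of_real a))\<^sup>2 * a = (cmod w)\<^sup>2 / a"
          using \<open>a > 0\<close> by (simp add: norm_divide power2_eq_square)
        ultimately show ?thesis
          unfolding quad_form_add_axis[OF herm] w_def[symmetric] a_def[symmetric] by auto
      qed
      moreover have "0 \<le> Re (quad_form A (x + axis p (- w / of_real a)))"
        using assms unfolding pos_semidef_iff_quad_form by blast
      moreover have "quad_form A x = quad_form (A - outer v) x + quad_form (outer v) x"
        by (simp flip: quad_form_add)
      ultimately show ?thesis by simp
    qed
    moreover have "hermitian_matrix (A - outer v)"
      by (simp add: hermitian_matrix_iff_cnj outer_v cnj_A mult.commute)
    ultimately have "pos_semidef (A - outer v)"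
      by (simp add: pos_semidef_iff_quad_form)
    moreover have "(A - outer v) $ p $ c = 0" for c
      using \<open>a > 0\<close> by (simp add: outer_v a)
    \<comment> \<open>This keeps rows that are already zero equal to zero in later
      eliminations.\<close>
    moreover have "v $ r = 0" if "A $ r $ p = 0" for r
      using that by (simp add: v_def)
    ultimately show ?thesis by (rule that)
  qed
qed

text \<open>Induction on a finite set \<open>S\<close> containing the indices of all nonzero rows of
  \<open>A\<close>. Eliminating \<open>p\<close> splits \<open>A\<close> into \<open>outer v\<close>
  and a semidefinite remainder supported on fewer rows; the product with \<open>B\<close>
  distributes over the two parts.\<close>

lemma pos_semidef_mult:
  fixes A B :: "complex ^ 'm ^ 'm"
  assumes A: "pos_semidef A" and B: "pos_semidef B"
  shows "pos_semidef (A * B)"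
proof -
  have "pos_semidef (A * B)"
    if "finite S" "pos_semidef A" "\<And>r c. r \<notin> S \<Longrightarrow> A $ r $ c = 0" for S and A :: "complex ^ 'm ^ 'm"
    using that
  proof (induction S arbitrary: A)
    case empty
    then have "A = 0" by (simp add: vec_eq_iff)
    then show ?case by (simp add: pos_semidef_zero)
  next
    case (insert p S)
    obtain v where v: "pos_semidef (A - outer v)" "\<And>c. (A - outer v) $ p $ c = 0"
      "\<And>r. A $ r $ p = 0 \<Longrightarrow> v $ r = 0"
      using pos_semidef_eliminate[OF insert.prems(1)] by blast
    have "(A - outer v) $ r $ c = 0" if "r \<notin> S" for r c
    proof (cases "r = p")
      case True
      then show ?thesis using v(2) by blast
    next
      case False
      then have row: "A $ r $ c = 0" for c
        using insert.prems(2) that by blast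
      then show ?thesis
        using v(3)[OF row] by (simp add: outer_def)
    qed
    then have "pos_semidef ((A - outer v) * B)"
      using insert.IH v(1) by blast
    then have "pos_semidef ((A - outer v) * B + outer v * B)"
      using pos_semidef_outer_mult[OF B] by (rule pos_semidef_add)
    then show ?case by (simp add: algebra_simps)
  qed
  from this[of UNIV A] show ?thesis
    using A by simp
qed

text \<open>Multiplication in this ring is the Hadamard product, so closure of the cone under
  products is Schur's theorem, and membership of a difference in the cone is the Loewner
  order.\<close>

interpretation pos_semidef: positive_cone "Collect pos_semidef :: (complex ^ 'm ^ 'm) set"
  by unfold_locales
    (simp_all add: pos_semidef_zero pos_semidef_one pos_semidef_add pos_semidef_mult)

theorem theorem33:
  fixes A :: "nat \<Rightarrow> nat \<Rightarrow> complex ^ 'm ^ 'm"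
    and k n :: nat
    and \<sigma> :: "nat \<Rightarrow> nat \<Rightarrow> nat"
  assumes "\<And>i j. i \<in> {1..k} \<Longrightarrow> j \<in> {1..n} \<Longrightarrow> pos_semidef (A i j)"
    and "\<And>i j. i \<in> {1..k} \<Longrightarrow> j \<in> {1..<n} \<Longrightarrow> A i j \<preceq>\<^sub>L A i (Suc j)"
    and "\<And>j. j \<in> {1..k} \<Longrightarrow> \<sigma> j permutes {1..n}"
  shows "(\<Sum>i = 1..n. \<Prod>j = 1..k. A j (\<sigma> j i)) \<preceq>\<^sub>L (\<Sum>i = 1..n. \<Prod>j = 1..k. A j i)
    \<and> (\<Prod>i = 1..n. \<Sum>j = 1..k. A j (\<sigma> j i)) \<succeq>\<^sub>L (\<Prod>i = 1..n. \<Sum>j = 1..k. A j i)"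
  using pos_semidef.sum_of_prods_rearrangement[of "{1..k}" n A \<sigma>]
    pos_semidef.prod_of_sums_rearrangement[of "{1..k}" n A \<sigma>] assms
  by (simp add: loewner_le_def)

end
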